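(* Any quasigroup that is central in the sense of Belyavskaya and Smith is an A-central quasigroup.
   Context: A quasigroup $(Q,\cdot)$ is a non-empty set $Q$ with a binary operation such that for all $a,b\in Q$ the equations $x\cdot a=b$ and $a\cdot y=b$ each have a unique solution. Central quasigroups in the sense of Belyavskaya and Smith are those that coincide with their center; by Belyavskaya's theorem they are exactly the T-quasigroups, i.e. the quasigroups $(Q,\cdot)$ for which there exist an abelian group $(Q,+)$, automorphisms $\varphi,\psi$ of $(Q,+)$ and a fixed element $a\in Q$ such that $x\cdot y=\varphi x+\psi y+a$ for all $x,y\in Q$. $\varepsilon$ is the identity permutation of $Q$. An autotopy of $(Q,\cdot)$ is a triple $(\alpha,\beta,\gamma)$ of permutations of $Q$ with $\alpha x\cdot\beta y=\gamma(x\cdot y)$ for all $x,y\in Q$; autotopies form a group $Avt(Q,\cdot)$ under component-wise composition. The A-nuclei are the groups of autotopies: $N^A_l$, those of the form $(\alpha,\varepsilon,\gamma)$; $N^A_r$, those of the form $(\varepsilon,\beta,\gamma)$; $N^A_m$, those of the form $(\alpha,\beta,\varepsilon)$. They are normal subgroups of $Avt(Q,\cdot)$ intersecting pairwise trivially; $N^A_r\times N^A_m$, etc., denote the internal direct products in $Avt(Q,\cdot)$. The A-centers are $Z^A_l=(N^A_r\times N^A_m)\cap N^A_l$, $Z^A_r=(N^A_l\times N^A_m)\cap N^A_r$, $Z^A_m=(N^A_l\times N^A_r)\cap N^A_m$. Their components are the permutation groups ${}_1Z^A_l,{}_3Z^A_l$ (first, third components of elements of $Z^A_l$), ${}_2Z^A_r,{}_3Z^A_r$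 (second, third components of elements of $Z^A_r$), ${}_1Z^A_m,{}_2Z^A_m$ (first, second components of elements of $Z^A_m$). $(Q,\cdot)$ is A-central if at least one of these six component groups acts transitively on $Q$. *)

theory Defs
  imports "HOL-Algebra.Group_Action"
begin

locale quasigroup =
  fixes Q :: "'a set" and f :: "'a \<Rightarrow> 'a \<Rightarrow> 'a"
  assumes nonempty: "Q \<noteq> {}"
    and closed: "\<lbrakk>x \<in> Q; y \<in> Q\<rbrakk> \<Longrightarrow> f x y \<in> Q"
    and left_division: "\<lbrakk>a \<in> Q; b \<in> Q\<rbrakk> \<Longrightarrow> \<exists>!x. x \<in> Q \<and> f x a = b"
    and right_division: "\<lbrakk>a \<in> Q; b \<in> Q\<rbrakk> \<Longrightarrow> \<exists>!y. y \<in> Q \<and> f a y = b"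


section \<open>Central quasigroups\<close>

text \<open>
  The congruences of a quasigroup, regarded as an algebra with multiplication and both
  divisions, are the equivalence relations that are compatible with the multiplication and
  admit cancellation (\<open>normal\<close> congruences).
\<close>

definition normal_congruence :: "'a set \<Rightarrow> ('a \<Rightarrow> 'a \<Rightarrow> 'a) \<Rightarrow> 'a rel \<Rightarrow> bool" where
  "normal_congruence Q f \<theta> \<longleftrightarrow>
     equiv Q \<theta> \<and>
     (\<forall>x y u v. (x, y) \<in> \<theta> \<longrightarrow> (u, v) \<in> \<theta> \<longrightarrow> (f x u, f y v) \<in> \<theta>) \<and>
     (\<forall>x\<in>Q. \<forall>y\<in>Q. \<forall>c\<in>Q. (f x c, f y c) \<in> \<theta> \<longrightarrow> (x, y) \<in> \<theta>) \<and>
     (\<forall>x\<in>Q. \<forall>y\<in>Q. \<forall>c\<in>Q. (f c x, f c y) \<in> \<theta> \<longrightarrow> (x, y) \<in> \<theta>)"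

definition square_op :: "('a \<Rightarrow> 'a \<Rightarrow> 'a) \<Rightarrow> 'a \<times> 'a \<Rightarrow> 'a \<times> 'a \<Rightarrow> 'a \<times> 'a" where
  "square_op f p q = (f (fst p) (fst q), f (snd p) (snd q))"

text \<open>
  A congruence \<open>\<alpha>\<close> is itself a subquasigroup of the direct square.  In the sense of Smith it is
  central if the diagonal is a normal subquasigroup of \<open>\<alpha>\<close>, i.e. a class of some congruence
  of the quasigroup \<open>\<alpha>\<close>.
\<close>

definition central_congruence :: "'a set \<Rightarrow> ('a \<Rightarrow> 'a \<Rightarrow> 'a) \<Rightarrow> 'a rel \<Rightarrow> bool" where
  "central_congruence Q f \<alpha> \<longleftrightarrow>
     normal_congruence Q f \<alpha> \<and>
     (\<exists>V. normal_congruence \<alpha> (square_op f) V \<and> Id_on Q \<in> \<alpha> // V)"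

definition is_center :: "'a set \<Rightarrow> ('a \<Rightarrow> 'a \<Rightarrow> 'a) \<Rightarrow> 'a rel \<Rightarrow> bool" where
  "is_center Q f \<zeta> \<longleftrightarrow>
     central_congruence Q f \<zeta> \<and> (\<forall>\<alpha>. central_congruence Q f \<alpha> \<longrightarrow> \<alpha> \<subseteq> \<zeta>)"

text \<open>
  The center as a congruence is the universal one precisely when its classes, the centers as
  normal subquasigroups, are all of \<open>Q\<close>.
\<close>

definition central_quasigroup :: "'a set \<Rightarrow> ('a \<Rightarrow> 'a \<Rightarrow> 'a) \<Rightarrow> bool" where
  "central_quasigroup Q f \<longleftrightarrow> quasigroup Q f \<and> is_center Q f (Q \<times> Q)"

definition T_quasigroup :: "'a set \<Rightarrow> ('a \<Rightarrow> 'a \<Rightarrow> 'a) \<Rightarrow> bool" where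
  "T_quasigroup Q f \<longleftrightarrow>
     quasigroup Q f \<and>
     (\<exists>(G :: 'a monoid) \<phi> \<psi> a. comm_group G \<and> carrier G = Q \<and> \<phi> \<in> iso G G \<and> \<psi> \<in> iso G G \<and> a \<in> Q \<and>
        (\<forall>x\<in>Q. \<forall>y\<in>Q. f x y = \<phi> x \<otimes>\<^bsub>G\<^esub> \<psi> y \<otimes>\<^bsub>G\<^esub> a))"

section \<open>Autotopies, A-nuclei and A-centers\<close>

definition Avt :: "'a set \<Rightarrow> ('a \<Rightarrow> 'a \<Rightarrow> 'a) \<Rightarrow> (('a \<Rightarrow> 'a) \<times> ('a \<Rightarrow> 'a) \<times> ('a \<Rightarrow> 'a)) monoid" where
  "Avt Q f = (BijGroup Q \<times>\<times> BijGroup Q \<times>\<times> BijGroup Q)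
     \<lparr>carrier := {(\<alpha>, \<beta>, \<gamma>). \<alpha> \<in> Bij Q \<and> \<beta> \<in> Bij Q \<and> \<gamma> \<in> Bij Q \<and>
                    (\<forall>x\<in>Q. \<forall>y\<in>Q. f (\<alpha> x) (\<beta> y) = \<gamma> (f x y))}\<rparr>"

definition A_nucleus_l where
  "A_nucleus_l Q f = {(\<alpha>, \<beta>, \<gamma>) \<in> carrier (Avt Q f). \<beta> = \<one>\<^bsub>BijGroup Q\<^esub>}"

definition A_nucleus_r where
  "A_nucleus_r Q f = {(\<alpha>, \<beta>, \<gamma>) \<in> carrier (Avt Q f). \<alpha> = \<one>\<^bsub>BijGroup Q\<^esub>}"

definition A_nucleus_m where
  "A_nucleus_m Q f = {(\<alpha>, \<beta>, \<gamma>) \<in> carrier (Avt Q f). \<gamma> = \<one>\<^bsub>BijGroup Q\<^esub>}"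

text \<open>
  The A-nuclei are normal subgroups of \<^term>\<open>Avt Q f\<close> with pairwise trivial intersection, so
  the internal direct product of two of them is their complex product.
\<close>

definition A_center_l where
  "A_center_l Q f = (A_nucleus_r Q f <#>\<^bsub>Avt Q f\<^esub> A_nucleus_m Q f) \<inter> A_nucleus_l Q f"

definition A_center_r where
  "A_center_r Q f = (A_nucleus_l Q f <#>\<^bsub>Avt Q f\<^esub> A_nucleus_m Q f) \<inter> A_nucleus_r Q f"

definition A_center_m where
  "A_center_m Q f = (A_nucleus_l Q f <#>\<^bsub>Avt Q f\<^esub> A_nucleus_r Q f) \<inter> A_nucleus_m Q f"

abbreviation component1 :: "('a \<times> 'b \<times> 'c) set \<Rightarrow> 'a set" where
  "component1 S \<equiv> (\<lambda>(\<alpha>, \<beta>, \<gamma>). \<alpha>) ` S"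

abbreviation component2 :: "('a \<times> 'b \<times> 'c) set \<Rightarrow> 'b set" where
  "component2 S \<equiv> (\<lambda>(\<alpha>, \<beta>, \<gamma>). \<beta>) ` S"

abbreviation component3 :: "('a \<times> 'b \<times> 'c) set \<Rightarrow> 'c set" where
  "component3 S \<equiv> (\<lambda>(\<alpha>, \<beta>, \<gamma>). \<gamma>) ` S"

definition transitive_permutation_group :: "'a set \<Rightarrow> ('a \<Rightarrow> 'a) set \<Rightarrow> bool" where
  "transitive_permutation_group Q H \<longleftrightarrow>
     transitive_action ((BijGroup Q)\<lparr>carrier := H\<rparr>) Q (\<lambda>\<sigma>. \<sigma>)"

definition A_central :: "'a set \<Rightarrow> ('a \<Rightarrow> 'a \<Rightarrow> 'a) \<Rightarrow> bool" where
  "A_central Q f \<longleftrightarrow>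
     quasigroup Q f \<and>
     (transitive_permutation_group Q (component1 (A_center_l Q f)) \<or>
      transitive_permutation_group Q (component3 (A_center_l Q f)) \<or>
      transitive_permutation_group Q (component2 (A_center_r Q f)) \<or>
      transitive_permutation_group Q (component3 (A_center_r Q f)) \<or>
      transitive_permutation_group Q (component1 (A_center_m Q f)) \<or>
      transitive_permutation_group Q (component2 (A_center_m Q f)))"


section \<open>Belyavskaya's theorem: central quasigroups are the T-quasigroups\<close>

lemma central_quasigroup_iff_diagonal_normal:
  assumes "quasigroup Q f"
  shows "central_quasigroup Q f \<longleftrightarrow>
    (\<exists>V. normal_congruence (Q \<times> Q) (square_op f) V \<and> Id_on Q \<in> (Q \<times> Q) // V)"
proof -
  interpret quasigroup Q f by fact
  have "normal_congruence Q f (Q \<times> Q)"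
    unfolding normal_congruence_def equiv_def refl_on_def sym_on_def trans_def
    using closed by auto
  moreover have "\<alpha> \<subseteq> Q \<times> Q" if "central_congruence Q f \<alpha>" for \<alpha>
    using that by (simp add: central_congruence_def normal_congruence_def equiv_def)
  ultimately show ?thesis
    using assms by (auto simp: central_quasigroup_def is_center_def central_congruence_def)
qed

lemma T_quasigroup_imp_central:
  assumes "T_quasigroup Q f"
  shows "central_quasigroup Q f"
proof -
  obtain G :: "'a monoid" and \<phi> \<psi> a where
    G: "comm_group G" and Q: "carrier G = Q" and phi: "\<phi> \<in> iso G G" and psi: "\<psi> \<in> iso G G"
    and a: "a \<in> Q" and f: "\<And>x y. x \<in> Q \<Longrightarrow> y \<in> Q \<Longrightarrow> f x y = \<phi> x \<otimes>\<^bsub>G\<^esub> \<psi> y \<otimes>\<^bsub>G\<^esub> a"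
    and qg: "quasigroup Q f"
    using assms unfolding T_quasigroup_def by blast
  interpret comm_group G by fact
  interpret quasigroup Q f by fact
  have hom: "h x \<in> Q" "h (x \<otimes>\<^bsub>G\<^esub> y) = h x \<otimes>\<^bsub>G\<^esub> h y" "h x = h y \<longleftrightarrow> x = y"
    if "h \<in> iso G G" "x \<in> Q" "y \<in> Q" for h x y
    using that Q unfolding iso_def hom_def bij_betw_def inj_on_def by auto
  note [simp] = hom[OF phi] hom[OF psi]
  have [simp]: "x \<otimes>\<^bsub>G\<^esub> y \<in> Q" if "x \<in> Q" "y \<in> Q" for x y
    using that Q m_closed by auto
  have lc: "z \<otimes>\<^bsub>G\<^esub> x = z \<otimes>\<^bsub>G\<^esub> y \<longleftrightarrow> x = y" if "x \<in> Q" "y \<in> Q" "z \<in> Q" for x y z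
    using that Q by auto
  have ac: "x \<otimes>\<^bsub>G\<^esub> y \<otimes>\<^bsub>G\<^esub> z = x \<otimes>\<^bsub>G\<^esub> (y \<otimes>\<^bsub>G\<^esub> z)" "x \<otimes>\<^bsub>G\<^esub> y = y \<otimes>\<^bsub>G\<^esub> x"
    "x \<otimes>\<^bsub>G\<^esub> (y \<otimes>\<^bsub>G\<^esub> z) = y \<otimes>\<^bsub>G\<^esub> (x \<otimes>\<^bsub>G\<^esub> z)" if "x \<in> Q" "y \<in> Q" "z \<in> Q" for x y z
    using that Q by (auto simp: m_ac)
  define V where "V = {((x, y), (z, w)). x \<in> Q \<and> y \<in> Q \<and> z \<in> Q \<and> w \<in> Q \<and> y \<otimes>\<^bsub>G\<^esub> z = x \<otimes>\<^bsub>G\<^esub> w}"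
  have V: "((x, y), (z, w)) \<in> V \<longleftrightarrow> x \<in> Q \<and> y \<in> Q \<and> z \<in> Q \<and> w \<in> Q \<and> y \<otimes>\<^bsub>G\<^esub> z = x \<otimes>\<^bsub>G\<^esub> w" for x y z w
    unfolding V_def by auto
  have trans: "y \<otimes>\<^bsub>G\<^esub> z' = x \<otimes>\<^bsub>G\<^esub> w'"
    if "x \<in> Q" "y \<in> Q" "z \<in> Q" "w \<in> Q" "z' \<in> Q" "w' \<in> Q"
      "y \<otimes>\<^bsub>G\<^esub> z = x \<otimes>\<^bsub>G\<^esub> w" "w \<otimes>\<^bsub>G\<^esub> z' = z \<otimes>\<^bsub>G\<^esub> w'" for x y z w z' w'
  proof -
    have "z \<otimes>\<^bsub>G\<^esub> (y \<otimes>\<^bsub>G\<^esub> z') = (y \<otimes>\<^bsub>G\<^esub> z) \<otimes>\<^bsub>G\<^esub> z'" using that(1-6) by (simp add: ac)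
    also have "\<dots> = (x \<otimes>\<^bsub>G\<^esub> w) \<otimes>\<^bsub>G\<^esub> z'" using that(7) by (simp only:)
    also have "\<dots> = x \<otimes>\<^bsub>G\<^esub> (w \<otimes>\<^bsub>G\<^esub> z')" using that(1-6) by (simp only: ac)
    also have "\<dots> = x \<otimes>\<^bsub>G\<^esub> (z \<otimes>\<^bsub>G\<^esub> w')" using that(8) by (simp only:)
    also have "\<dots> = z \<otimes>\<^bsub>G\<^esub> (x \<otimes>\<^bsub>G\<^esub> w')" using that(1-6) by (simp add: ac)
    finally show ?thesis using that lc by simp
  qed
  have comp: "f y y' \<otimes>\<^bsub>G\<^esub> f z z' = f x x' \<otimes>\<^bsub>G\<^esub> f w w' \<longleftrightarrow>
     \<phi> (y \<otimes>\<^bsub>G\<^esub> z) \<otimes>\<^bsub>G\<^esub> \<psi> (y' \<otimes>\<^bsub>G\<^esub> z') = \<phi> (x \<otimes>\<^bsub>G\<^esub> w) \<otimes>\<^bsub>G\<^esub> \<psi> (x' \<otimes>\<^bsub>G\<^esub> w')"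
    if "x \<in> Q" "y \<in> Q" "z \<in> Q" "w \<in> Q" "x' \<in> Q" "y' \<in> Q" "z' \<in> Q" "w' \<in> Q" for x y z w x' y' z' w'
  proof -
    have *: "f y y' \<otimes>\<^bsub>G\<^esub> f z z' = (a \<otimes>\<^bsub>G\<^esub> a) \<otimes>\<^bsub>G\<^esub> (\<phi> (y \<otimes>\<^bsub>G\<^esub> z) \<otimes>\<^bsub>G\<^esub> \<psi> (y' \<otimes>\<^bsub>G\<^esub> z'))"
      if "z \<in> Q" "y \<in> Q" "y' \<in> Q" "z' \<in> Q" for y y' z z'
      using that a by (simp add: f ac)
    show ?thesis using that a by (simp add: * lc)
  qed
  have "normal_congruence (Q \<times> Q) (square_op f) V"
    unfolding normal_congruence_def
  proof (intro conjI)
    show "equiv (Q \<times> Q) V"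
    proof (rule equivI)
      show "V \<subseteq> (Q \<times> Q) \<times> (Q \<times> Q)" unfolding V_def by auto
      show "refl_on (Q \<times> Q) V" unfolding refl_on_def by (auto simp: V ac)
      show "sym V" by (rule symI) (auto simp: V ac)
      show "trans V" by (rule transI) (auto simp: V intro: trans)
    qed
    show "\<forall>x y u v. (x, y) \<in> V \<longrightarrow> (u, v) \<in> V \<longrightarrow> (square_op f x u, square_op f y v) \<in> V"
      by (auto simp: V square_op_def closed comp simp del: hom)
    show "\<forall>x\<in>Q \<times> Q. \<forall>y\<in>Q \<times> Q. \<forall>c\<in>Q \<times> Q.
      (square_op f x c, square_op f y c) \<in> V \<longrightarrow> (x, y) \<in> V"
    proof clarify
      fix x y z w c d
      assume q: "x \<in> Q" "y \<in> Q" "z \<in> Q" "w \<in> Q" "c \<in> Q" "d \<in> Q"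
        and "(square_op f (x, y) (c, d), square_op f (z, w) (c, d)) \<in> V"
      then have "f y d \<otimes>\<^bsub>G\<^esub> f z c = f x c \<otimes>\<^bsub>G\<^esub> f w d" by (auto simp: V square_op_def)
      then have "\<psi> (c \<otimes>\<^bsub>G\<^esub> d) \<otimes>\<^bsub>G\<^esub> \<phi> (y \<otimes>\<^bsub>G\<^esub> z) = \<psi> (c \<otimes>\<^bsub>G\<^esub> d) \<otimes>\<^bsub>G\<^esub> \<phi> (x \<otimes>\<^bsub>G\<^esub> w)"
        using q by (simp add: comp) (simp add: ac)
      then show "((x, y), (z, w)) \<in> V" using q by (simp add: V lc del: hom(2)[OF phi] hom(2)[OF psi])
    qed
    show "\<forall>x\<in>Q \<times> Q. \<forall>y\<in>Q \<times> Q. \<forall>c\<in>Q \<times> Q.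
      (square_op f c x, square_op f c y) \<in> V \<longrightarrow> (x, y) \<in> V"
    proof clarify
      fix x y z w c d
      assume q: "x \<in> Q" "y \<in> Q" "z \<in> Q" "w \<in> Q" "c \<in> Q" "d \<in> Q"
        and "(square_op f (c, d) (x, y), square_op f (c, d) (z, w)) \<in> V"
      then have "f d y \<otimes>\<^bsub>G\<^esub> f c z = f c x \<otimes>\<^bsub>G\<^esub> f d w" by (auto simp: V square_op_def)
      then have "\<phi> (c \<otimes>\<^bsub>G\<^esub> d) \<otimes>\<^bsub>G\<^esub> \<psi> (y \<otimes>\<^bsub>G\<^esub> z) = \<phi> (c \<otimes>\<^bsub>G\<^esub> d) \<otimes>\<^bsub>G\<^esub> \<psi> (x \<otimes>\<^bsub>G\<^esub> w)"
        using q by (simp add: comp) (simp add: ac)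
      then show "((x, y), (z, w)) \<in> V" using q by (simp add: V lc del: hom(2)[OF phi] hom(2)[OF psi])
    qed
  qed
  moreover have "Id_on Q \<in> (Q \<times> Q) // V"
  proof -
    obtain e where e: "e \<in> Q" using nonempty by blast
    have "V `` {(e, e)} = Id_on Q" using e by (auto simp: V Id_on_def lc)
    then show ?thesis using e by (auto simp: quotient_def)
  qed
  ultimately show ?thesis using central_quasigroup_iff_diagonal_normal[OF qg] by blast
qed

lemma central_imp_T_quasigroup:
  assumes "central_quasigroup Q f"
  shows "T_quasigroup Q f"
proof -
  have qg: "quasigroup Q f" using assms by (simp add: central_quasigroup_def)
  interpret quasigroup Q f by fact
  obtain V where nc: "normal_congruence (Q \<times> Q) (square_op f) V" and diag: "Id_on Q \<in> (Q \<times> Q) // V"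
    using assms central_quasigroup_iff_diagonal_normal[OF qg] by blast
  define R where "R x y z w \<longleftrightarrow> ((x, y), (z, w)) \<in> V" for x y z w
  have eq: "equiv (Q \<times> Q) V" using nc by (simp add: normal_congruence_def)
  have dom: "x \<in> Q \<and> y \<in> Q \<and> z \<in> Q \<and> w \<in> Q" if "R x y z w" for x y z w
    using that eq unfolding R_def equiv_def by blast
  have R_refl: "R x y x y" if "x \<in> Q" "y \<in> Q" for x y
    using that eq unfolding R_def equiv_def refl_on_def by blast
  have R_sym: "R z w x y" if "R x y z w" for x y z w
    using that eq by (auto simp: R_def equiv_def dest: symD)
  have R_trans: "R x y u v" if "R x y z w" "R z w u v" for x y z w u v
    using that eq by (auto simp: R_def equiv_def dest: transD)
  have R_mult: "R (f x x') (f y y') (f z z') (f w w')" if "R x y z w" "R x' y' z' w'" for x y z w x' y' z' w'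
  proof -
    have "(square_op f (x, y) (x', y'), square_op f (z, w) (z', w')) \<in> V"
      using nc that unfolding normal_congruence_def R_def by blast
    then show ?thesis by (simp add: R_def square_op_def)
  qed
  have R_diag: "R x x y y" if "x \<in> Q" "y \<in> Q" for x y
  proof -
    have "(x, x) \<in> Id_on Q" "(y, y) \<in> Id_on Q" using that by auto
    then show ?thesis using diag eq unfolding R_def by (metis quotient_eqI quotient_eq_iff)
  qed
  have R_diagD: "z = w" if "R x x z w" for x z w
  proof -
    have "(x, x) \<in> Id_on Q" using dom[OF that] by auto
    then have "(z, w) \<in> Id_on Q" using diag eq that unfolding R_def by (meson in_quotient_imp_closed)
    then show ?thesis by auto
  qed
  have ld: "\<exists>x\<in>Q. f x a = b" and rd: "\<exists>y\<in>Q. f a y = b" if "a \<in> Q" "b \<in> Q" for a b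
    using left_division[OF that] right_division[OF that] by blast+
  have lcan: "x = y" if "f a x = f a y" "a \<in> Q" "x \<in> Q" "y \<in> Q" for a x y
    using right_division[of a "f a x"] that closed by metis
  have rcan: "x = y" if "f x a = f y a" "a \<in> Q" "x \<in> Q" "y \<in> Q" for a x y
    using left_division[of a "f x a"] that closed by metis
  have R_uniq: "w = w'" if "R x y z w" "R x y z w'" for x y z w w'
  proof -
    have q: "z \<in> Q" "w \<in> Q" "w' \<in> Q" using that dom by blast+
    obtain h where h: "h \<in> Q" "f w h = f z z" using rd q closed by metis
    have "R z w z w'" using that R_sym R_trans by blast
    then have "R (f z z) (f w h) (f z z) (f w' h)" using R_mult R_refl h q by blast
    then have "f z z = f w' h" using h R_diagD by metis
    then show ?thesis using h q rcan by metis
  qed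
  text \<open>Every instance of \<open>R\<close> has the shape below, whence the symmetries of \<open>R\<close>.\<close>
  have R_ex: "\<exists>r\<in>Q. \<exists>s\<in>Q. \<exists>d\<in>Q. f r c = x \<and> f s c = y \<and> f r d = z" if "x \<in> Q" "y \<in> Q" "z \<in> Q" "c \<in> Q" for x y z c
    using that ld rd by metis
  have R_form: "R (f r c) (f s c) (f r d) (f s d)" if "r \<in> Q" "s \<in> Q" "c \<in> Q" "d \<in> Q" for r s c d
    using R_mult[OF R_refl[of r s] R_diag[of c d]] that by blast
  have R_form': "R (f r c) (f r d) (f s c) (f s d)" if "r \<in> Q" "s \<in> Q" "c \<in> Q" "d \<in> Q" for r s c d
    using R_mult[OF R_diag[of r s] R_refl[of c d]] that by blast
  have R_elim: "\<exists>r\<in>Q. \<exists>s\<in>Q. \<exists>d\<in>Q. f r c = x \<and> f s c = y \<and> f r d = z \<and> f s d = w"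
    if R: "R x y z w" and c: "c \<in> Q" for x y z w c
  proof -
    obtain r s d where *: "r \<in> Q" "s \<in> Q" "d \<in> Q" "f r c = x" "f s c = y" "f r d = z"
      using R_ex[of x y z c] dom[OF R] c by blast
    then have "R x y z (f s d)" using R_form c by blast
    then show ?thesis using R_uniq[OF R] * by blast
  qed
  obtain e where e: "e \<in> Q" using nonempty by blast
  have R_total: "\<exists>w. R x y z w" if "x \<in> Q" "y \<in> Q" "z \<in> Q" for x y z
    using R_ex[OF that e] R_form e by blast
  have R_swap: "R x z y w" if "R x y z w" for x y z w
    using R_elim[OF that e] R_form' e by blast
  have R_rev: "R y x w z" if "R x y z w" for x y z w
    using R_elim[OF that e] R_form e by blast
  define p where "p x y = (THE w. R e x y w)" for x y
  have p: "R e x y (p x y)" if "x \<in> Q" "y \<in> Q" for x y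
    unfolding p_def using R_total[OF e that] R_uniq by (metis theI')
  have p_eq: "p x y = w" if "R e x y w" for x y w
    using R_uniq that p dom by blast
  have p_closed: "p x y \<in> Q" if "x \<in> Q" "y \<in> Q" for x y
    using p[OF that] dom by blast
  define G where "G = \<lparr>carrier = Q, mult = p, one = e\<rparr>"
  have G_simps [simp]: "carrier G = Q" "mult G = p" "one G = e" by (simp_all add: G_def)
  have p_comm: "p x y = p y x" if "x \<in> Q" "y \<in> Q" for x y
    using R_swap[OF p[OF that]] p_eq by metis
  have p_assoc: "p (p x y) z = p x (p y z)" if "x \<in> Q" "y \<in> Q" "z \<in> Q" for x y z
  proof -
    have "R e z y (p y z)" using p[of z y] that p_comm by simp
    moreover have "R e z (p x y) (p (p x y) z)" using p[of z "p x y"] that p_comm p_closed by simp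
    ultimately have "R y (p y z) (p x y) (p (p x y) z)" using R_sym R_trans by blast
    then have "R y (p x y) (p y z) (p (p x y) z)" by (rule R_swap)
    then have "R e x (p y z) (p (p x y) z)" using p R_trans that by blast
    then show ?thesis using p_eq by metis
  qed
  have G: "comm_group G"
  proof (rule comm_groupI; simp only: G_simps)
    show "p e x = x" if "x \<in> Q" for x using that e R_diag by (intro p_eq) blast
    show "\<exists>y\<in>Q. p y x = e" if x: "x \<in> Q" for x
    proof -
      obtain y where "R x e e y" using R_total x e by blast
      then have "R e x y e" by (rule R_rev)
      then show ?thesis using p_eq p_comm dom by metis
    qed
  qed (use e p_closed p_comm p_assoc in auto)
  interpret G: comm_group G by fact
  have i [simp]: "inv\<^bsub>G\<^esub> x \<in> Q" if "x \<in> Q" for x using that G.inv_closed by simp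
  have R_iff: "w = p (p y z) (inv\<^bsub>G\<^esub> x)" if R: "R x y z w" for x y z w
  proof -
    have q: "x \<in> Q" "y \<in> Q" "z \<in> Q" using dom[OF R] by auto
    let ?t = "p z (inv\<^bsub>G\<^esub> x)"
    have t: "?t \<in> Q" using q p_closed by simp
    have "R e ?t x (p ?t x)" "R e ?t y (p ?t y)" using p q t by auto
    then have "R x y (p ?t x) (p ?t y)" using R_sym R_trans R_swap by blast
    moreover have "p ?t x = z" using q G.inv_solve_right' G.m_assoc[of z "inv\<^bsub>G\<^esub> x" x] G.l_inv[of x] G.r_one[of z] by simp
    ultimately have "w = p ?t y" using R R_uniq by metis
    then show ?thesis using q p_comm p_assoc p_closed i by metis
  qed
  let ?a = "f e e"
  have a: "?a \<in> Q" using e closed by blast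
  define \<phi> \<psi> where "\<phi> x = p (f x e) (inv\<^bsub>G\<^esub> ?a)" and "\<psi> x = p (f e x) (inv\<^bsub>G\<^esub> ?a)" for x
  have cl: "\<phi> x \<in> Q" "\<psi> x \<in> Q" if "x \<in> Q" for x
    using that e a by (auto simp: \<phi>_def \<psi>_def p_closed closed)
  have bck: "p (p y (inv\<^bsub>G\<^esub> ?a)) ?a = y" if "y \<in> Q" for y
    using that a G.m_assoc[of y "inv\<^bsub>G\<^esub> ?a" ?a] G.l_inv[of ?a] G.r_one[of y] by simp
  have forth: "p (p y ?a) (inv\<^bsub>G\<^esub> ?a) = y" if "y \<in> Q" for y
    using that a G.m_assoc[of y ?a "inv\<^bsub>G\<^esub> ?a"] G.r_inv[of ?a] G.r_one[of y] by simp
  have mid: "p (p u v) (inv\<^bsub>G\<^esub> ?a) = p (p (p u (inv\<^bsub>G\<^esub> ?a)) (p v (inv\<^bsub>G\<^esub> ?a))) ?a"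
    if "u \<in> Q" "v \<in> Q" for u v
  proof -
    let ?i = "inv\<^bsub>G\<^esub> ?a"
    have "p (p (p u ?i) (p v ?i)) ?a = p (p u ?i) v"
      using that a bck by (simp add: p_assoc p_closed)
    also have "\<dots> = p u (p v ?i)" using that a p_comm[of ?i v] by (simp add: p_assoc)
    finally show ?thesis using that a by (simp add: p_assoc)
  qed
  have canc: "x = y" if "p x u = p y u" "x \<in> Q" "y \<in> Q" "u \<in> Q" for x y u
    using that G.right_cancel[of u x y] by simp
  have f_eq: "f x y = p (p (\<phi> x) (\<psi> y)) ?a" if "x \<in> Q" "y \<in> Q" for x y
  proof -
    have "R (f e e) (f x e) (f e y) (f x y)" using R_form that e by blast
    from R_iff[OF this] show ?thesis unfolding \<phi>_def \<psi>_def
      using mid closed that e by simp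
  qed
  have phi: "\<phi> \<in> iso G G"
  proof (rule isoI)
    have "\<phi> (p x y) = p (\<phi> x) (\<phi> y)" if "x \<in> Q" "y \<in> Q" for x y
    proof -
      have "R (f e e) (f x e) (f y e) (f (p x y) e)" using R_mult[OF p[OF that] R_refl[OF e e]] .
      from R_iff[OF this] have "f (p x y) e = p (p (\<phi> x) (\<phi> y)) ?a"
        unfolding \<phi>_def using mid closed that e by simp
      then show ?thesis using forth cl that p_closed by (simp add: \<phi>_def[of "p x y"])
    qed
    then show "\<phi> \<in> hom G G" using cl by (auto simp: hom_def)
    have "inj_on \<phi> Q" unfolding inj_on_def \<phi>_def using canc rcan e a closed i by metis
    moreover have "\<exists>x\<in>Q. \<phi> x = y" if "y \<in> Q" for y
      using ld[OF e, of "p y ?a"] that a p_closed forth unfolding \<phi>_def by metis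
    ultimately show "bij_betw \<phi> (carrier G) (carrier G)"
      using cl by (auto simp: bij_betw_def)
  qed
  have psi: "\<psi> \<in> iso G G"
  proof (rule isoI)
    have "\<psi> (p x y) = p (\<psi> x) (\<psi> y)" if "x \<in> Q" "y \<in> Q" for x y
    proof -
      have "R (f e e) (f e x) (f e y) (f e (p x y))" using R_mult[OF R_refl[OF e e] p[OF that]] .
      from R_iff[OF this] have "f e (p x y) = p (p (\<psi> x) (\<psi> y)) ?a"
        unfolding \<psi>_def using mid closed that e by simp
      then show ?thesis using forth cl that p_closed by (simp add: \<psi>_def[of "p x y"])
    qed
    then show "\<psi> \<in> hom G G" using cl by (auto simp: hom_def)
    have "inj_on \<psi> Q" unfolding inj_on_def \<psi>_def using canc lcan e a closed i by metis
    moreover have "\<exists>x\<in>Q. \<psi> x = y" if "y \<in> Q" for y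
      using rd[OF e, of "p y ?a"] that a p_closed forth unfolding \<psi>_def by metis
    ultimately show "bij_betw \<psi> (carrier G) (carrier G)"
      using cl by (auto simp: bij_betw_def)
  qed
  show ?thesis
    unfolding T_quasigroup_def
    using qg G phi psi a f_eq by (intro conjI exI[of _ G] exI[of _ \<phi>] exI[of _ \<psi>] exI[of _ ?a]) auto
qed

theorem central_quasigroup_iff_T_quasigroup:
  "central_quasigroup Q f \<longleftrightarrow> T_quasigroup Q f"
  using central_imp_T_quasigroup T_quasigroup_imp_central by blast

end

theory Submission
  imports Defs
begin

text \<open>
  By Belyavskaya's theorem the operation is \<open>x \<cdot> y = \<phi> x + \<psi> y + a\<close> over an abelian group.
  Write \<open>L\<^sub>c\<close> for the translation \<open>u \<mapsto> c + u\<close>.  The third component \<open>\<gamma>\<close> of an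
  autotopy \<open>(\<alpha>, \<epsilon>, \<gamma>)\<close> satisfies \<open>\<gamma> (\<phi> x + \<psi> y + a) = \<phi> (\<alpha> x) + \<psi> y + a\<close>; putting \<open>x = 0\<close>
  and using that \<open>\<psi> y + a\<close> runs through all of \<open>Q\<close>, one gets \<open>\<gamma> = L\<^sub>c\<close> with \<open>c = \<phi> (\<alpha> 0)\<close>
  (\<open>left_nucleus_third_component\<close>).  Conversely, for every \<open>c\<close>, with
  \<open>\<phi> b = c = \<psi> d\<close>, the factorization
  \<open>(L\<^sub>b, \<epsilon>, L\<^sub>c) = (\<epsilon>, L\<^sub>d, L\<^sub>c) (L\<^sub>b, L\<^sub>-\<^sub>d, \<epsilon>)\<close>
  writes an element of the left A-nucleus as a product of elements of the right and the middle
  A-nucleus, so it lies in the left A-center (\<open>translation_in_left_center\<close>).  Hence the third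
  components of the left A-center are exactly the translations, and these form a transitive
  group.
\<close>

text \<open>
  Left translation by \<open>c\<close>, restricted to the carrier because the elements of
  \<^term>\<open>BijGroup (carrier G)\<close> are extensional functions.
\<close>

definition translation :: "('a, 'b) monoid_scheme \<Rightarrow> 'a \<Rightarrow> 'a \<Rightarrow> 'a" where
  "translation G c = (\<lambda>u\<in>carrier G. c \<otimes>\<^bsub>G\<^esub> u)"

context group
begin

lemma translation_apply [simp]: "u \<in> carrier G \<Longrightarrow> translation G c u = c \<otimes> u"
  by (simp add: translation_def)

lemma translation_Bij:
  assumes "c \<in> carrier G"
  shows "translation G c \<in> Bij (carrier G)"
proof -
  have "bij_betw (translation G c) (carrier G) (carrier G)"
    by (rule bij_betw_byWitness[where f' = "translation G (inv c)"])
       (use assms in \<open>auto simp: m_assoc[symmetric]\<close>)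
  then show ?thesis
    by (simp add: Bij_def translation_def)
qed

lemma translation_group_hom: "group_hom G (BijGroup (carrier G)) (translation G)"
proof (intro group_hom.intro group_hom_axioms.intro is_group group_BijGroup homI)
  fix c d assume "c \<in> carrier G" "d \<in> carrier G"
  then have "translation G (c \<otimes> d) = compose (carrier G) (translation G c) (translation G d)"
    by (auto simp: translation_def compose_def m_assoc)
  then show "translation G (c \<otimes> d) =
      translation G c \<otimes>\<^bsub>BijGroup (carrier G)\<^esub> translation G d"
    using \<open>c \<in> carrier G\<close> \<open>d \<in> carrier G\<close> by (simp add: BijGroup_def translation_Bij)
qed (simp add: BijGroup_def translation_Bij)

lemma translations_transitive:
  "transitive_permutation_group (carrier G) (translation G ` carrier G)"
proof -
  interpret T: group_hom G "BijGroup (carrier G)" "translation G"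
    by (rule translation_group_hom)
  have sub: "subgroup (translation G ` carrier G) (BijGroup (carrier G))"
    by (rule T.img_is_subgroup)
  then have "group_action ((BijGroup (carrier G))\<lparr>carrier := translation G ` carrier G\<rparr>)
      (carrier G) (\<lambda>\<sigma>. \<sigma>)"
    by (intro group_action.intro group_hom.intro group_hom_axioms.intro subgroup.subgroup_is_group
        group_BijGroup homI) (auto dest: subgroup.mem_carrier)
  moreover have "\<exists>\<sigma>\<in>translation G ` carrier G. \<sigma> x = y"
    if "x \<in> carrier G" "y \<in> carrier G" for x y
  proof -
    have "translation G (y \<otimes> inv x) x = y"
      using that by (simp add: m_assoc del: T.hom_mult)
    then show ?thesis
      using that by blast
  qed
  ultimately show ?thesis
    unfolding transitive_permutation_group_def
    by (intro transitive_action.intro transitive_action_axioms.intro) auto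
qed

end

text \<open>
  A T-quasigroup with a chosen linear representation.
\<close>

locale T_representation = comm_group G for G (structure) +
  fixes f :: "'a \<Rightarrow> 'a \<Rightarrow> 'a" and \<phi> \<psi> a
  assumes phi: "\<phi> \<in> iso G G" and psi: "\<psi> \<in> iso G G" and a: "a \<in> carrier G"
    and f_eq: "\<lbrakk>x \<in> carrier G; y \<in> carrier G\<rbrakk> \<Longrightarrow> f x y = \<phi> x \<otimes> \<psi> y \<otimes> a"
begin

lemma phi_psi_closed [simp]:
  assumes "x \<in> carrier G"
  shows "\<phi> x \<in> carrier G" "\<psi> x \<in> carrier G"
  using assms phi psi by (auto simp: iso_def hom_def)

lemma phi_psi_mult [simp]:
  assumes "x \<in> carrier G" "y \<in> carrier G"
  shows "\<phi> (x \<otimes> y) = \<phi> x \<otimes> \<phi> y" "\<psi> (x \<otimes> y) = \<psi> x \<otimes> \<psi> y"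
  using assms phi psi by (auto simp: iso_def hom_def)

lemma phi_one [simp]: "\<phi> \<one> = \<one>"
  and psi_one [simp]: "\<psi> \<one> = \<one>"
  using hom_one[of \<phi> G G] hom_one[of \<psi> G G] phi psi is_group by (auto simp: iso_def)

lemma phi_surj:
  assumes "c \<in> carrier G"
  obtains b where "b \<in> carrier G" "\<phi> b = c"
proof -
  have "c \<in> \<phi> ` carrier G"
    using assms phi by (simp add: iso_def bij_betw_def)
  then show thesis using that by blast
qed

lemma psi_surj:
  assumes "c \<in> carrier G"
  obtains d where "d \<in> carrier G" "\<psi> d = c"
proof -
  have "c \<in> \<psi> ` carrier G"
    using assms psi by (simp add: iso_def bij_betw_def)
  then show thesis using that by blast
qed

lemma left_nucleus_third_component:
  assumes "(\<alpha>, \<beta>, \<gamma>) \<in> A_nucleus_l (carrier G) f"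
  shows "\<gamma> \<in> translation G ` carrier G"
proof -
  have \<beta>: "\<beta> = (\<lambda>x\<in>carrier G. x)" and \<alpha>\<gamma>: "\<alpha> \<in> Bij (carrier G)" "\<gamma> \<in> Bij (carrier G)"
    and aut: "\<And>x y. \<lbrakk>x \<in> carrier G; y \<in> carrier G\<rbrakk> \<Longrightarrow> f (\<alpha> x) (\<beta> y) = \<gamma> (f x y)"
    using assms by (auto simp: A_nucleus_l_def Avt_def BijGroup_def)
  have \<alpha>: "\<alpha> \<one> \<in> carrier G"
    using Bij_imp_funcset[OF \<alpha>\<gamma>(1)] by auto
  have "\<gamma> u = \<phi> (\<alpha> \<one>) \<otimes> u" if u: "u \<in> carrier G" for u
  proof -
    obtain y where y: "y \<in> carrier G" "\<psi> y = u \<otimes> inv a"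
      using psi_surj u a by (metis inv_closed m_closed)
    then have "\<psi> y \<otimes> a = u"
      using u a by (simp add: m_assoc)
    moreover have "\<gamma> (\<psi> y \<otimes> a) = \<phi> (\<alpha> \<one>) \<otimes> (\<psi> y \<otimes> a)"
      using aut[of \<one> y] y(1) \<alpha> a by (simp add: \<beta> f_eq m_assoc)
    ultimately show ?thesis by simp
  qed
  then have "\<gamma> = translation G (\<phi> (\<alpha> \<one>))"
    using Bij_imp_extensional[OF \<alpha>\<gamma>(2)]
    by (intro extensionalityI[of _ "carrier G"]) (auto simp: translation_def)
  then show ?thesis using \<alpha> by simp
qed

lemma translation_autotopy:
  assumes "b \<in> carrier G" "d \<in> carrier G"
  shows "(translation G b, translation G d, translation G (\<phi> b \<otimes> \<psi> d))
    \<in> carrier (Avt (carrier G) f)"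
proof -
  have "f (b \<otimes> x) (d \<otimes> y) = \<phi> b \<otimes> \<psi> d \<otimes> f x y"
    if "x \<in> carrier G" "y \<in> carrier G" for x y
    using that assms a by (simp add: f_eq m_ac)
  moreover have "f x y \<in> carrier G" if "x \<in> carrier G" "y \<in> carrier G" for x y
    using that a by (simp add: f_eq)
  ultimately show ?thesis
    using assms by (simp add: Avt_def translation_Bij)
qed

lemma translation_in_left_center:
  assumes b: "b \<in> carrier G"
  shows "(translation G b, \<one>\<^bsub>BijGroup (carrier G)\<^esub>, translation G (\<phi> b))
    \<in> A_center_l (carrier G) f"
proof -
  let ?B = "BijGroup (carrier G)" and ?L = "translation G"
  interpret T: group_hom G ?B ?L by (rule translation_group_hom)
  obtain d where d: "d \<in> carrier G" "\<psi> d = \<phi> b"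
    using psi_surj b by (metis phi_psi_closed(1))
  have "\<psi> d \<otimes> \<psi> (inv d) = \<one>"
    using phi_psi_mult(2)[of d "inv d"] d(1) by simp
  then have cancel: "\<phi> b \<otimes> \<psi> (inv d) = \<one>"
    by (simp add: d(2))
  have l: "(?L b, \<one>\<^bsub>?B\<^esub>, ?L (\<phi> b)) \<in> A_nucleus_l (carrier G) f"
    using translation_autotopy[of b \<one>] b by (simp add: A_nucleus_l_def)
  have r: "(\<one>\<^bsub>?B\<^esub>, ?L d, ?L (\<phi> b)) \<in> A_nucleus_r (carrier G) f"
    using translation_autotopy[of \<one> d] b d by (simp add: A_nucleus_r_def)
  have m: "(?L b, ?L (inv d), \<one>\<^bsub>?B\<^esub>) \<in> A_nucleus_m (carrier G) f"
    using translation_autotopy[of b "inv d"] b d(1) by (simp add: A_nucleus_m_def cancel)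
  have "?L d \<otimes>\<^bsub>?B\<^esub> ?L (inv d) = \<one>\<^bsub>?B\<^esub>"
    using T.hom_mult[of d "inv d"] d(1) by (simp del: T.hom_mult T.hom_inv)
  then have "(?L b, \<one>\<^bsub>?B\<^esub>, ?L (\<phi> b))
      = (\<one>\<^bsub>?B\<^esub>, ?L d, ?L (\<phi> b)) \<otimes>\<^bsub>Avt (carrier G) f\<^esub> (?L b, ?L (inv d), \<one>\<^bsub>?B\<^esub>)"
    using b by (simp add: Avt_def DirProd_def)
  then have "(?L b, \<one>\<^bsub>?B\<^esub>, ?L (\<phi> b)) \<in>
      A_nucleus_r (carrier G) f <#>\<^bsub>Avt (carrier G) f\<^esub> A_nucleus_m (carrier G) f"
    unfolding set_mult_def using r m by blast
  with l show ?thesis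
    by (simp add: A_center_l_def)
qed

lemma component3_left_center:
  "component3 (A_center_l (carrier G) f) = translation G ` carrier G"
proof (intro equalityI subsetI)
  fix \<gamma> assume "\<gamma> \<in> component3 (A_center_l (carrier G) f)"
  then show "\<gamma> \<in> translation G ` carrier G"
    by (auto simp: A_center_l_def dest: left_nucleus_third_component)
next
  fix \<gamma> assume "\<gamma> \<in> translation G ` carrier G"
  then obtain b where "b \<in> carrier G" "\<gamma> = translation G (\<phi> b)"
    using phi_surj by (metis imageE)
  then show "\<gamma> \<in> component3 (A_center_l (carrier G) f)"
    using translation_in_left_center by force
qed

end

theorem corollary3p25:
  fixes Q :: "'a set" and f :: "'a \<Rightarrow> 'a \<Rightarrow> 'a"
  assumes "central_quasigroup Q f"
  shows "A_central Q f"
proof -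
  obtain G :: "'a monoid" and \<phi> \<psi> a where
    G: "comm_group G" and Q: "carrier G = Q" and "\<phi> \<in> iso G G" "\<psi> \<in> iso G G" "a \<in> Q"
    "\<forall>x\<in>Q. \<forall>y\<in>Q. f x y = \<phi> x \<otimes>\<^bsub>G\<^esub> \<psi> y \<otimes>\<^bsub>G\<^esub> a"
    and qg: "quasigroup Q f"
    using central_imp_T_quasigroup[OF assms] unfolding T_quasigroup_def by blast
  then interpret T_representation G f \<phi> \<psi> a
    by (intro T_representation.intro T_representation_axioms.intro) auto
  have "transitive_permutation_group Q (component3 (A_center_l Q f))"
    using translations_transitive component3_left_center Q by simp
  then show ?thesis
    using qg by (simp add: A_central_def)
qed

end
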